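(* Let $T$ be a $\Delta(1,2,2)$-free tournament. Then one of the following holds: (1) $T$ is isomorphic to a basic tournament; (2) $T$ is obtained from a transitive tournament by reversing the edges of vertex-disjoint directed paths; (3) $T$ contains a homogeneous set $X$ such that $T[X]$ is isomorphic to $T_5$ or $P_7$; or (4) $T$ contains a homogeneous pair $(D_1,D_2)$ such that $T[D_1\cup D_2]$ is isomorphic to $P_7^-$ and $(D_1,D_2)$ is the degree partition of this subtournament.
   Context: Tournaments are finite orientations of complete graphs; $T[X]$ is the subtournament induced on $X$, and $T\setminus X$ is $T[V(T)\setminus X]$. $T$ is $S$-free if no induced subtournament is isomorphic to $S$. For disjoint nonempty $X,Y$, $X\Rightarrow Y$ means every edge between $X$ and $Y$ is directed from $X$ to $Y$. $\Delta(1,2,2)$ is the tournament on $\{x,y_1,y_2,z_1,z_2\}$ with $x\Rightarrow\{y_1,y_2\}\Rightarrow\{z_1,z_2\}\Rightarrow x$ and edges $y_1y_2$, $z_1z_2$. $T_5$ has vertices $v_1,\dots,v_5$ with $v_iv_j\in E$ iff $j-i\equiv1,2\pmod 5$. $P_7$ has vertices $v_1,\dots,v_7$ with $v_iv_j\in E$ iff $j-i\equiv 1,2,4\pmod 7$. $P_7^-$ is $P_7$ with one vertex deleted (well defined up to isomorphism). The basic tournaments are $T_5,P_7^-,P_7$. The degree partition of $P_7^-$ is $(D_1,D_2)$ where $D_1$ is the set of vertices of out-degree $3$ and $D_2$ the set of vertices of out-degree $2$ in $P_7^-$. A nonempty $X\subseteq V(T)$ is a homogeneous set if every $v\in V(T)\setminus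 X$ satisfies $v\Rightarrow X$ or $X\Rightarrow v$. For nonempty disjoint $A_1,A_2$, $(A_1,A_2)$ is a homogeneous pair if $A_1$ is a homogeneous set of $T\setminus A_2$ and $A_2$ is a homogeneous set of $T\setminus A_1$. *)

theory Defs
  imports "Graph_Theory.Graph_Theory"
begin

text \<open>
  \<open>digraph\<close> supplies finiteness and the absence of loops and multiple arcs.
  The null tournament is not excluded.
\<close>

locale tournament = digraph +
  assumes tournament_arcs:
    "\<lbrakk>u \<in> verts G; v \<in> verts G; u \<noteq> v\<rbrakk> \<Longrightarrow> (u \<rightarrow> v) \<longleftrightarrow> \<not> (v \<rightarrow> u)"

definition free_of :: "('a, 'b) pre_digraph \<Rightarrow> ('c, 'd) pre_digraph \<Rightarrow> bool" where
  "free_of G S \<longleftrightarrow> \<not> (\<exists>X \<subseteq> verts G. digraph_iso (G \<restriction> X) S)"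

text \<open>
  In a tournament every two distinct vertices are joined by exactly one arc, so that all arcs
  between disjoint \<open>X\<close> and \<open>Y\<close> go from \<open>X\<close> to \<open>Y\<close> iff all of these arcs are present.
\<close>

definition complete_to :: "('a, 'b) pre_digraph \<Rightarrow> 'a set \<Rightarrow> 'a set \<Rightarrow> bool" where
  "complete_to G X Y \<longleftrightarrow>
     X \<noteq> {} \<and> Y \<noteq> {} \<and> X \<inter> Y = {} \<and> (\<forall>x \<in> X. \<forall>y \<in> Y. x \<rightarrow>\<^bsub>G\<^esub> y)"

definition homogeneous_set :: "('a, 'b) pre_digraph \<Rightarrow> 'a set \<Rightarrow> bool" where
  "homogeneous_set G X \<longleftrightarrow>
     X \<noteq> {} \<and> X \<subseteq> verts G \<and>
     (\<forall>v \<in> verts G - X. complete_to G {v} X \<or> complete_to G X {v})"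

definition homogeneous_pair :: "('a, 'b) pre_digraph \<Rightarrow> 'a set \<Rightarrow> 'a set \<Rightarrow> bool" where
  "homogeneous_pair G A\<^sub>1 A\<^sub>2 \<longleftrightarrow>
     A\<^sub>1 \<noteq> {} \<and> A\<^sub>2 \<noteq> {} \<and> A\<^sub>1 \<inter> A\<^sub>2 = {} \<and>
     homogeneous_set (G \<restriction> (verts G - A\<^sub>2)) A\<^sub>1 \<and>
     homogeneous_set (G \<restriction> (verts G - A\<^sub>1)) A\<^sub>2"

datatype delta_vertex = Delta_x | Delta_y1 | Delta_y2 | Delta_z1 | Delta_z2

definition Delta_1_2_2 :: "delta_vertex pair_pre_digraph" where
  "Delta_1_2_2 = \<lparr> pverts = {Delta_x, Delta_y1, Delta_y2, Delta_z1, Delta_z2},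
     parcs = {Delta_x} \<times> {Delta_y1, Delta_y2} \<union>
             {Delta_y1, Delta_y2} \<times> {Delta_z1, Delta_z2} \<union>
             {Delta_z1, Delta_z2} \<times> {Delta_x} \<union>
             {(Delta_y1, Delta_y2), (Delta_z1, Delta_z2)} \<rparr>"

definition T5 :: "int pair_pre_digraph" where
  "T5 = \<lparr> pverts = {1..5},
     parcs = {(i, j). i \<in> {1..5} \<and> j \<in> {1..5} \<and> (j - i) mod 5 \<in> {1, 2}} \<rparr>"

definition P7 :: "int pair_pre_digraph" where
  "P7 = \<lparr> pverts = {1..7},
     parcs = {(i, j). i \<in> {1..7} \<and> j \<in> {1..7} \<and> (j - i) mod 7 \<in> {1, 2, 4}} \<rparr>"

text \<open>The choice of the deleted vertex is immaterial, as the rotations are automorphisms of \<open>P7\<close>.\<close>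

definition P7_minus :: "(int, int \<times> int) pre_digraph" where
  "P7_minus = pre_digraph.del_vert (with_proj P7) 7"

text \<open>Meaningful for copies of \<open>P7_minus\<close> only, whose out-degrees are 2 and 3.\<close>

definition degree_partition :: "('a, 'b) pre_digraph \<Rightarrow> 'a set \<times> 'a set" where
  "degree_partition G =
     ({v \<in> verts G. out_degree G v = 3}, {v \<in> verts G. out_degree G v = 2})"

definition reverse_arcs :: "'a pair_pre_digraph \<Rightarrow> ('a \<times> 'a) set \<Rightarrow> 'a pair_pre_digraph" where
  "reverse_arcs G E = G\<lparr> parcs := (parcs G - E) \<union> E\<inverse> \<rparr>"

text \<open>
  The paths are directed paths of the transitive tournament \<open>H\<close>, given by their vertex sequences.
  Their arcs need not join consecutive vertices of the linear order underlying \<open>H\<close>.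
\<close>

definition path_reversal_of_transitive :: "'a pair_pre_digraph \<Rightarrow> bool" where
  "path_reversal_of_transitive T \<longleftrightarrow>
     (\<exists>H \<P>. tournament (with_proj H) \<and> trans (parcs H) \<and>
        (\<forall>p \<in> \<P>. vpath p (with_proj H)) \<and>
        pairwise (\<lambda>p q. set p \<inter> set q = {}) \<P> \<and>
        T = reverse_arcs H (\<Union>p \<in> \<P>. set (vwalk_arcs p)))"

end

theory Submission
  imports Defs
begin

text \<open>
  A vertex outside a copy of \<open>T5\<close> is uniform to the copy, and a vertex outside a copy of \<open>P7_minus\<close>
  is uniform to each of its two degree classes. So one may assume that there are no such copies,
  and then it suffices to order the vertices by decreasing score (out-degree): every vertex
  has at most one backward out-neighbour and at most one backward in-neighbour. The reason is
  that \<open>u \<leadsto> a \<leadsto> b\<close> and \<open>u \<leadsto> b\<close> imply \<open>score b \<le> score u\<close>, as otherwise three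
  out-neighbours of \<open>b\<close> would dominate \<open>u\<close>, two of which yield a \<open>Delta_1_2_2\<close>.
  Ties matter only on cyclic triangles of equal scores. Such a triangle is a homogeneous set
  and contains all vertices of its score, so any of its three rotations will do as the order.
\<close>

subsection \<open>Delta-free tournaments\<close>

lemma card_diff_mono:
  assumes "finite A" "finite B" "card A \<le> card B"
  shows "card (A - B) \<le> card (B - A)"
proof -
  have "card A = card (A \<inter> B) + card (A - B)" "card B = card (A \<inter> B) + card (B - A)"
    using card_Int_Diff[of A B] card_Int_Diff[of B A] assms by (simp_all add: Int_commute)
  then show ?thesis using assms by simp
qed

lemma two_le_card_obtain:
  assumes "2 \<le> card S"
  obtains p q where "p \<in> S" "q \<in> S" "p \<noteq> q"
proof -
  have "finite S" using assms by (metis card.infinite not_numeral_le_zero)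
  then show thesis using assms card_le_Suc0_iff_eq[of S] that by fastforce
qed

lemma two_le_card:
  assumes "p \<in> S" "q \<in> S" "p \<noteq> q" "finite S"
  shows "2 \<le> card S"
  using card_mono[of S "{p, q}"] assms by simp

text \<open>In \<open>delta_free\<close> the arcs between \<open>y\<close> and \<open>y'\<close> and
  between \<open>z\<close> and \<open>z'\<close> are left open: exchanging the names within either
  pair covers both of its orientations. An appeal to it thus needs eight arcs and two inequalities
  only.\<close>

locale delta_free_tournament =
  fixes V :: "'a set" and A :: "'a rel"
  assumes finite_verts: "finite V"
    and arcs_subset: "A \<subseteq> V \<times> V"
    and irrefl: "(u, u) \<notin> A"
    and semiconnex: "\<lbrakk>u \<in> V; v \<in> V; u \<noteq> v\<rbrakk> \<Longrightarrow> (u, v) \<in> A \<or> (v, u) \<in> A"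
    and asym: "(u, v) \<in> A \<Longrightarrow> (v, u) \<notin> A"
    and delta_free: "\<lbrakk>(x, y) \<in> A; (x, y') \<in> A; (y, z) \<in> A; (y, z') \<in> A; (y', z) \<in> A;
      (y', z') \<in> A; (z, x) \<in> A; (z', x) \<in> A\<rbrakk> \<Longrightarrow> y = y' \<or> z = z'"
begin

abbreviation arc :: "'a \<Rightarrow> 'a \<Rightarrow> bool" (infix "\<leadsto>" 50) where
  "u \<leadsto> v \<equiv> (u, v) \<in> A"

definition out :: "'a \<Rightarrow> 'a set" where
  "out v = {w. v \<leadsto> w}"

abbreviation score :: "'a \<Rightarrow> nat" where
  "score v \<equiv> card (out v)"

lemma mem_out [simp]: "w \<in> out v \<longleftrightarrow> v \<leadsto> w"
  by (simp add: out_def)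

lemma finite_out [simp]: "finite (out v)"
  by (rule finite_subset[OF _ finite_verts]) (use arcs_subset in auto)

lemma in_verts: "u \<leadsto> v \<Longrightarrow> u \<in> V" "u \<leadsto> v \<Longrightarrow> v \<in> V"
  using arcs_subset by auto

text \<open>Discarding the common out-neighbours preserves the comparison of scores, so
  \<open>y\<close> has at least as many private out-neighbours as \<open>x\<close>. This is how
  comparisons of scores produce new vertices below.\<close>

lemma two_outneighbours:
  assumes "score x \<le> score y" "x \<leadsto> p" "x \<leadsto> q" "\<not> y \<leadsto> p" "\<not> y \<leadsto> q" "p \<noteq> q"
  obtains r s where "y \<leadsto> r" "y \<leadsto> s" "\<not> x \<leadsto> r" "\<not> x \<leadsto> s" "r \<noteq> s"
proof -
  have "2 \<le> card (out x - out y)"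
    using assms by (intro two_le_card[of p _ q]) auto
  also have "\<dots> \<le> card (out y - out x)"
    using assms by (intro card_diff_mono) auto
  finally show thesis
    by (elim two_le_card_obtain) (use that in auto)
qed

lemma other_outneighbour:
  assumes "score x \<le> score y" "x \<leadsto> p" "x \<leadsto> q" "\<not> y \<leadsto> p" "\<not> y \<leadsto> q" "p \<noteq> q"
  obtains r where "y \<leadsto> r" "\<not> x \<leadsto> r" "r \<noteq> t"
  using two_outneighbours[OF assms] by metis

lemma score_le_of_transitive_triple:
  assumes "u \<leadsto> a" "a \<leadsto> b" "u \<leadsto> b"
  shows "score b \<le> score u"
proof (rule ccontr)
  assume less: "\<not> score b \<le> score u"
  have eq: "card (out u) + card (out b - out u) = card (out b) + card (out u - out b)"
    using card_Int_Diff[of "out u" "out b"] card_Int_Diff[of "out b" "out u"]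
    by (simp add: Int_commute)
  \<comment> \<open>The two elements are \<open>a\<close> and \<open>b\<close> themselves. The
    strict inequality of scores then yields a third vertex on the other side.\<close>
  have "2 \<le> card (out u - out b)"
    using assms irrefl asym by (intro two_le_card[of a _ b]) auto
  then have "3 \<le> card (out b - out u)" using eq less by linarith
  then obtain Z where Z: "Z \<subseteq> out b - out u" "card Z = 3"
    by (meson obtain_subset_with_card_n)
  then obtain p q r where pqr: "Z = {p, q, r}" "p \<noteq> q" "q \<noteq> r" "p \<noteq> r"
    by (auto simp: card_3_iff)
  have from_b: "b \<leadsto> z" "\<not> u \<leadsto> z" "z \<in> V" if "z \<in> Z" for z
    using that Z in_verts by auto
  have V: "u \<in> V" "a \<in> V" using assms in_verts by blast+
  have "z \<noteq> u" "z \<noteq> a" if "z \<in> Z" for z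
    using from_b[OF that] assms asym by blast+
  then have to_u: "z \<leadsto> u" and to_a: "z \<leadsto> a \<or> a \<leadsto> z" if "z \<in> Z" for z
    using that from_b[OF that] V semiconnex[of u z] semiconnex[of a z] by blast+
  have "a \<noteq> b" "u \<noteq> a" using assms irrefl by blast+
  \<comment> \<open>Two vertices of \<open>Z\<close> on the same side of \<open>a\<close> are
    forbidden: u => {a, b} => {z, z'} => u if \<open>a\<close> dominates both, and b => {z, z'} =>
    {u, a} => b if both dominate \<open>a\<close>. Three vertices cannot avoid this.\<close>
  then have "z = z'" if "z \<in> Z" "z' \<in> Z" "a \<leadsto> z" "a \<leadsto> z'" for z z'
    using delta_free[of u a b z z'] that assms from_b to_u by blast
  moreover have "z = z'" if "z \<in> Z" "z' \<in> Z" "z \<leadsto> a" "z' \<leadsto> a" for z z'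
    using delta_free[of b z z' u a] that assms from_b to_u \<open>u \<noteq> a\<close> by blast
  moreover have "p \<in> Z" "q \<in> Z" "r \<in> Z" using pqr by auto
  ultimately show False using to_a pqr by metis
qed

section \<open>Copies of \<open>T5\<close> and \<open>P7_minus\<close> and the vertices outside
  them\<close>

definition T5_copy :: "'a \<Rightarrow> 'a \<Rightarrow> 'a \<Rightarrow> 'a \<Rightarrow> 'a \<Rightarrow> bool" where
  "T5_copy v1 v2 v3 v4 v5 \<longleftrightarrow>
     v1 \<leadsto> v2 \<and> v1 \<leadsto> v3 \<and> v2 \<leadsto> v3 \<and> v2 \<leadsto> v4 \<and> v3 \<leadsto> v4 \<and> v3 \<leadsto> v5 \<and> v4 \<leadsto> v5 \<and> v4 \<leadsto> v1 \<and>
     v5 \<leadsto> v1 \<and> v5 \<leadsto> v2"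

definition P7_minus_copy :: "'a \<Rightarrow> 'a \<Rightarrow> 'a \<Rightarrow> 'a \<Rightarrow> 'a \<Rightarrow> 'a \<Rightarrow> bool" where
  "P7_minus_copy v1 v2 v3 v4 v5 v6 \<longleftrightarrow>
     v1 \<leadsto> v2 \<and> v1 \<leadsto> v3 \<and> v1 \<leadsto> v5 \<and> v2 \<leadsto> v3 \<and> v2 \<leadsto> v4 \<and> v2 \<leadsto> v6 \<and> v3 \<leadsto> v4 \<and> v3 \<leadsto> v5 \<and>
     v4 \<leadsto> v5 \<and> v4 \<leadsto> v6 \<and> v4 \<leadsto> v1 \<and> v5 \<leadsto> v6 \<and> v5 \<leadsto> v2 \<and> v6 \<leadsto> v1 \<and> v6 \<leadsto> v3"

lemma T5_copy_rotate: "T5_copy v1 v2 v3 v4 v5 \<Longrightarrow> T5_copy v2 v3 v4 v5 v1"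
  by (simp add: T5_copy_def)

text \<open>Doubling modulo 7 is an automorphism of \<open>P7\<close> that fixes the deleted vertex 7.\<close>

lemma P7_minus_copy_rotate:
  "P7_minus_copy v1 v2 v3 v4 v5 v6 \<Longrightarrow> P7_minus_copy v2 v4 v6 v1 v3 v5"
  by (simp add: P7_minus_copy_def)

text \<open>The cyclic shift is an automorphism of \<open>T5\<close>, so this one step, applied to
  the five rotations of a copy, carries an arc from \<open>v\<close> all the way around it.\<close>

lemma T5_uniform_step:
  assumes T5_copy: "T5_copy v1 v2 v3 v4 v5"
    and v: "v \<in> V" "v \<notin> {v1, v2, v3, v4, v5}" and "v \<leadsto> v1"
  shows "v \<leadsto> v2"
proof (rule ccontr)
  assume "\<not> v \<leadsto> v2"
  note T5 = T5_copy[unfolded T5_copy_def]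
  have "{v1, v2, v3, v4, v5} \<subseteq> V" using T5 in_verts by blast
  then have "v \<leadsto> w \<or> w \<leadsto> v" if "w \<in> {v1, v2, v3, v4, v5}" for w
    using that v semiconnex[of v w] by blast
  then have "v \<leadsto> v2 \<or> v2 \<leadsto> v" "v \<leadsto> v3 \<or> v3 \<leadsto> v" "v \<leadsto> v4 \<or> v4 \<leadsto> v" "v \<leadsto> v5 \<or> v5 \<leadsto> v"
    by simp_all
  moreover have "v2 \<noteq> v3" "v4 \<noteq> v" "v1 \<noteq> v5" "v4 \<noteq> v5" "v1 \<noteq> v" "v2 \<noteq> v"
    "v3 \<noteq> v4" "v5 \<noteq> v" "v1 \<noteq> v2"
    using T5 v irrefl by auto
  \<comment> \<open>As \<open>v2 \<leadsto> v\<close>, the first three instances force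
    \<open>v \<leadsto> v3\<close>, \<open>v5 \<leadsto> v\<close> and
    \<open>v \<leadsto> v4\<close>; then v5 => {v2, v} => {v3, v4} => v5 is forbidden.\<close>
  ultimately show False
    using T5 \<open>v \<leadsto> v1\<close> \<open>\<not> v \<leadsto> v2\<close>
      delta_free[of v1 v2 v3 v4 v] delta_free[of v2 v4 v v1 v5] delta_free[of v3 v4 v5 v1 v]
      delta_free[of v5 v2 v v3 v4] delta_free[of v3 v5 v v1 v2]
    by satx
qed

text \<open>Under the three rotations of the copy, the first implication runs through the cycle v1,
  v2, v4 and the second through v3, v5, v6. These are the two degree classes.\<close>

lemma P7_minus_uniform_step:
  assumes P7_copy: "P7_minus_copy v1 v2 v3 v4 v5 v6"
    and v: "v \<in> V" "v \<notin> {v1, v2, v3, v4, v5, v6}"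
  shows "v \<leadsto> v1 \<Longrightarrow> v \<leadsto> v2" "v \<leadsto> v3 \<Longrightarrow> v \<leadsto> v5"
proof -
  note P7 = P7_copy[unfolded P7_minus_copy_def]
  have "{v1, v2, v3, v4, v5, v6} \<subseteq> V" using P7 in_verts by blast
  then have "v \<leadsto> w \<or> w \<leadsto> v" if "w \<in> {v1, v2, v3, v4, v5, v6}" for w
    using that v semiconnex[of v w] by blast
  then have vw: "v \<leadsto> v1 \<or> v1 \<leadsto> v" "v \<leadsto> v2 \<or> v2 \<leadsto> v" "v \<leadsto> v3 \<or> v3 \<leadsto> v"
    "v \<leadsto> v4 \<or> v4 \<leadsto> v" "v \<leadsto> v5 \<or> v5 \<leadsto> v" "v \<leadsto> v6 \<or> v6 \<leadsto> v"
    by simp_all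
  have ne: "v2 \<noteq> v3" "v4 \<noteq> v" "v2 \<noteq> v5" "v6 \<noteq> v" "v1 \<noteq> v5" "v1 \<noteq> v3" "v4 \<noteq> v5" "v2 \<noteq> v"
    using P7 v irrefl by auto
  \<comment> \<open>If \<open>v2 \<leadsto> v\<close>, then neither direction of the arc between
    \<open>v\<close> and \<open>v5\<close> is possible.\<close>
  show "v \<leadsto> v2" if "v \<leadsto> v1"
    using vw that P7 ne delta_free[of v1 v2 v3 v4 v] delta_free[of v1 v2 v5 v6 v]
      delta_free[of v2 v4 v v1 v5]
    by satx
  \<comment> \<open>If \<open>v5 \<leadsto> v\<close>, then \<open>v1 \<leadsto> v\<close> and
    \<open>v \<leadsto> v4\<close> are forced, and v4 => {v1, v5} => {v2, v} => v4 is
    forbidden.\<close>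
  show "v \<leadsto> v5" if "v \<leadsto> v3"
    using vw that P7 ne delta_free[of v5 v6 v v1 v3] delta_free[of v3 v4 v5 v6 v]
      delta_free[of v4 v1 v5 v2 v]
    by satx
qed

end

section \<open>Cyclic triangles of equal scores\<close>

locale basic_free_tournament = delta_free_tournament +
  assumes T5_free: "\<not> T5_copy v1 v2 v3 v4 v5"
    and P7_minus_free: "\<not> P7_minus_copy v1 v2 v3 v4 v5 v6"
begin

text \<open>Otherwise \<open>a \<leadsto> b\<close>, and comparing the tied scores twice produces
  vertices \<open>z\<close> and \<open>y\<close>. Whichever way the arcs among \<open>u\<close>,
  \<open>b\<close>, \<open>c\<close>, \<open>a\<close>, \<open>z\<close>, \<open>y\<close> go, they
  contain a \<open>Delta_1_2_2\<close> or a copy of \<open>T5\<close> or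
  \<open>P7_minus\<close>.\<close>

lemma tied_triangle_step:
  assumes triangle: "u \<leadsto> b" "b \<leadsto> c" "c \<leadsto> u"
    and tied: "score u = score b" "score b = score c"
    and a: "a \<noteq> b" "u \<leadsto> a"
  shows "b \<leadsto> a"
proof (rule ccontr)
  assume "\<not> b \<leadsto> a"
  have "a \<noteq> c" using a triangle asym by blast
  have V: "u \<in> V" "a \<in> V" "b \<in> V" "c \<in> V" using triangle a in_verts by blast+
  have "a \<leadsto> b" using \<open>\<not> b \<leadsto> a\<close> V a semiconnex by blast
  \<comment> \<open>\<open>u\<close> has the out-neighbours \<open>a\<close> and \<open>b\<close>,
    which \<open>b\<close> lacks, so \<open>b\<close> has two that \<open>u\<close> lacks; one of
    them is not \<open>c\<close>.\<close>
  obtain z where "b \<leadsto> z" "\<not> u \<leadsto> z" "z \<noteq> c"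
    using other_outneighbour[of u b a b] triangle tied a \<open>\<not> b \<leadsto> a\<close> irrefl by auto
  have "z \<in> V" using \<open>b \<leadsto> z\<close> in_verts by blast
  have "z \<leadsto> u" using \<open>\<not> u \<leadsto> z\<close> \<open>b \<leadsto> z\<close> triangle asym V \<open>z \<in> V\<close> semiconnex by blast
  have "z \<noteq> a" using \<open>\<not> b \<leadsto> a\<close> \<open>b \<leadsto> z\<close> by blast
  show False
  proof (cases "c \<leadsto> a")
    case True
    have "\<not> z \<leadsto> a"
      using delta_free[of b c z u a] triangle \<open>a \<leadsto> b\<close> \<open>b \<leadsto> z\<close> True \<open>z \<leadsto> u\<close> \<open>z \<noteq> c\<close> a irrefl
      by blast
    then have "a \<leadsto> z" using V \<open>z \<in> V\<close> \<open>z \<noteq> a\<close> semiconnex by blast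
    have "\<not> z \<leadsto> c"
      using T5_free[of a b z c u, unfolded T5_copy_def] triangle
        \<open>a \<leadsto> b\<close> \<open>b \<leadsto> z\<close> True \<open>z \<leadsto> u\<close> \<open>a \<leadsto> z\<close> a by blast
    then have "c \<leadsto> z" using V \<open>z \<in> V\<close> \<open>z \<noteq> c\<close> semiconnex by blast
    \<comment> \<open>Here \<open>c\<close> has the out-neighbours \<open>u\<close> and
      \<open>z\<close>, which \<open>u\<close> lacks.\<close>
    obtain y where "u \<leadsto> y" "\<not> c \<leadsto> y" "y \<noteq> b"
      using other_outneighbour[of c u u z b] triangle tied \<open>c \<leadsto> z\<close> \<open>\<not> u \<leadsto> z\<close> \<open>z \<leadsto> u\<close> irrefl
      by (metis order_refl)
    have "y \<in> V" using \<open>u \<leadsto> y\<close> in_verts by blast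
    have "y \<leadsto> c" using \<open>\<not> c \<leadsto> y\<close> \<open>u \<leadsto> y\<close> triangle asym V \<open>y \<in> V\<close> semiconnex by blast
    have "y \<noteq> a" "y \<noteq> z" using \<open>\<not> c \<leadsto> y\<close> \<open>c \<leadsto> a\<close> \<open>c \<leadsto> z\<close> by blast+
    moreover have "u \<noteq> y" "u \<noteq> a" "b \<noteq> y" "c \<noteq> z"
      using \<open>u \<leadsto> y\<close> a \<open>y \<noteq> b\<close> \<open>z \<noteq> c\<close> irrefl by blast+
    moreover from calculation have "y \<leadsto> a \<or> a \<leadsto> y" "y \<leadsto> z \<or> z \<leadsto> y" "y \<leadsto> b \<or> b \<leadsto> y"
      using V \<open>z \<in> V\<close> \<open>y \<in> V\<close> \<open>y \<noteq> b\<close> semiconnex by blast+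
    \<comment> \<open>\<open>y \<leadsto> a\<close> and \<open>z \<leadsto> y\<close> are forced.
      Then \<open>b \<leadsto> y\<close> completes a \<open>P7_minus\<close>, and
      \<open>y \<leadsto> b\<close> completes z => {u, y} => {a, b} => z.\<close>
    ultimately show False
      using delta_free[of c u a b y] delta_free[of u b y c z]
        P7_minus_free[of u b y c a z, unfolded P7_minus_copy_def]
        delta_free[of z u y a b] triangle a \<open>a \<leadsto> b\<close> \<open>b \<leadsto> z\<close> \<open>z \<leadsto> u\<close> \<open>a \<leadsto> z\<close>
        \<open>c \<leadsto> z\<close> \<open>u \<leadsto> y\<close> \<open>y \<leadsto> c\<close> True
      by satx
  next
    case False
    then have "a \<leadsto> c" using V \<open>a \<noteq> c\<close> semiconnex by blast
    have "\<not> a \<leadsto> z"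
      using delta_free[of u a b c z] triangle a \<open>a \<leadsto> b\<close> \<open>a \<leadsto> c\<close> \<open>b \<leadsto> z\<close> \<open>z \<leadsto> u\<close> \<open>z \<noteq> c\<close> irrefl
      by blast
    then have "z \<leadsto> a" using V \<open>z \<in> V\<close> \<open>z \<noteq> a\<close> semiconnex by blast
    have "\<not> c \<leadsto> z"
      using T5_free[of a b c z u, unfolded T5_copy_def] triangle
        \<open>a \<leadsto> b\<close> \<open>a \<leadsto> c\<close> \<open>b \<leadsto> z\<close> \<open>z \<leadsto> u\<close> \<open>z \<leadsto> a\<close> a by blast
    then have "z \<leadsto> c" using V \<open>z \<in> V\<close> \<open>z \<noteq> c\<close> semiconnex by blast
    \<comment> \<open>Now \<open>u\<close> has the out-neighbours \<open>a\<close> and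
      \<open>b\<close>, which \<open>c\<close> lacks.\<close>
    obtain y where "c \<leadsto> y" "\<not> u \<leadsto> y" "y \<noteq> u"
      using other_outneighbour[of u c a b u] eq_imp_le[of "score u" "score c"] triangle tied a
        False asym
      by auto
    have "y \<in> V" using \<open>c \<leadsto> y\<close> in_verts by blast
    have "y \<leadsto> u" using \<open>\<not> u \<leadsto> y\<close> \<open>y \<noteq> u\<close> V \<open>y \<in> V\<close> semiconnex by blast
    have "y \<noteq> a" "y \<noteq> b" "y \<noteq> z" using \<open>c \<leadsto> y\<close> False triangle asym \<open>\<not> c \<leadsto> z\<close> by blast+
    moreover have "c \<noteq> y" "c \<noteq> z" "u \<noteq> y" "u \<noteq> a" "z \<noteq> y"
      using \<open>c \<leadsto> y\<close> a \<open>y \<noteq> u\<close> \<open>z \<noteq> c\<close> \<open>y \<noteq> z\<close> irrefl by blast+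
    moreover from calculation have "y \<leadsto> a \<or> a \<leadsto> y" "y \<leadsto> z \<or> z \<leadsto> y" "y \<leadsto> b \<or> b \<leadsto> y"
      using V \<open>z \<in> V\<close> \<open>y \<in> V\<close> semiconnex by blast+
    \<comment> \<open>\<open>y \<leadsto> a\<close> fails for either direction between
      \<open>b\<close> and \<open>y\<close>. So \<open>a \<leadsto> y\<close>, which forces
      \<open>y \<leadsto> b\<close> and then \<open>y \<leadsto> z\<close>, completing a
      \<open>P7_minus\<close>.\<close>
    ultimately show False
      using delta_free[of u a b c y] delta_free[of b c z u y]
        P7_minus_free[of a y b z c u, unfolded P7_minus_copy_def]
        delta_free[of b z y u a] delta_free[of c u y a b]
        triangle a \<open>a \<leadsto> b\<close> \<open>b \<leadsto> z\<close> \<open>z \<leadsto> u\<close> \<open>z \<leadsto> a\<close>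
        \<open>z \<leadsto> c\<close> \<open>c \<leadsto> y\<close> \<open>y \<leadsto> u\<close> \<open>a \<leadsto> c\<close>
      by satx
  qed
qed

text \<open>Applied to the three rotations of the triangle, the step carries an arc into
  \<open>a\<close> around it and back to its start.\<close>

lemma tied_triangle_homogeneous:
  assumes triangle: "u \<leadsto> b" "b \<leadsto> c" "c \<leadsto> u"
    and tied: "score u = score b" "score b = score c"
    and a: "a \<in> V" "a \<notin> {u, b, c}"
  shows "u \<leadsto> a \<and> b \<leadsto> a \<and> c \<leadsto> a \<or> a \<leadsto> u \<and> a \<leadsto> b \<and> a \<leadsto> c"
proof -
  have "score c = score u" using tied by simp
  then have "u \<leadsto> a \<Longrightarrow> b \<leadsto> a" "b \<leadsto> a \<Longrightarrow> c \<leadsto> a" "c \<leadsto> a \<Longrightarrow> u \<leadsto> a"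
    using tied_triangle_step triangle tied a by blast+
  then show ?thesis using a triangle in_verts semiconnex by blast
qed

text \<open>If \<open>score a\<close> were not smaller, then for each arc
  \<open>v \<leadsto> w\<close> of the triangle, \<open>a\<close> would have to make up for the
  out-neighbours \<open>a\<close> and \<open>w\<close> of \<open>v\<close>. The two vertices gained
  dominate \<open>v\<close>, but not both dominate \<open>w\<close>, because of a => {p, p'} => {v,
  w} => a.\<close>

lemma score_less_of_tied_triangle:
  assumes triangle: "u \<leadsto> b" "b \<leadsto> c" "c \<leadsto> u"
    and tied: "score u = score b" "score b = score c"
    and a: "u \<leadsto> a" "b \<leadsto> a" "c \<leadsto> a"
  shows "score a < score u"
proof (rule ccontr)
  assume "\<not> score a < score u"
  then have le: "score u \<le> score a" "score b \<le> score a" "score c \<le> score a"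
    using tied by auto
  txt \<open>With one such \<open>p\<close> per arc of the triangle, a \<open>Delta_1_2_2\<close> or a \<open>P7_minus\<close> is unavoidable.\<close>
  have ex: "\<exists>p. a \<leadsto> p \<and> p \<leadsto> v \<and> w \<leadsto> p"
    if vw: "v \<leadsto> a" "w \<leadsto> a" "v \<leadsto> w" "score v \<le> score a" for v w
  proof -
    have "a \<noteq> w" "\<not> a \<leadsto> w" using vw irrefl asym by blast+
    then obtain p p' where p: "a \<leadsto> p" "a \<leadsto> p'" "\<not> v \<leadsto> p" "\<not> v \<leadsto> p'" "p \<noteq> p'"
      using two_outneighbours[of v a a w] vw irrefl by blast
    have "p \<leadsto> v" "p' \<leadsto> v"
      using p vw asym in_verts semiconnex[of v p] semiconnex[of v p'] by blast+
    moreover have "\<not> (p \<leadsto> w \<and> p' \<leadsto> w)"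
      using delta_free[of a p p' v w] p vw \<open>p \<leadsto> v\<close> \<open>p' \<leadsto> v\<close> irrefl by blast
    moreover have "p \<noteq> w" "p' \<noteq> w" using p vw asym by blast+
    ultimately show ?thesis
      using p vw in_verts semiconnex[of p w] semiconnex[of p' w] by blast
  qed
  obtain p where p: "a \<leadsto> p" "p \<leadsto> u" "b \<leadsto> p" using ex[of u b] triangle a le by blast
  obtain q where q: "a \<leadsto> q" "q \<leadsto> b" "c \<leadsto> q" using ex[of b c] triangle a le by blast
  obtain r where r: "a \<leadsto> r" "r \<leadsto> c" "u \<leadsto> r" using ex[of c u] triangle a le by blast
  have V: "{u, b, c, p, q, r} \<subseteq> V" using triangle p q r in_verts by auto
  have "p \<noteq> q" "q \<noteq> r" "p \<noteq> r" "p \<noteq> c" "q \<noteq> u" "r \<noteq> b"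
    using p q r a asym by blast+
  moreover have "c \<noteq> p" "u \<noteq> q" "b \<noteq> r" "u \<noteq> r" "b \<noteq> q" "u \<noteq> c" "a \<noteq> q" "u \<noteq> b" "a \<noteq> r"
    using triangle a p q r irrefl asym by blast+
  moreover from calculation have "p \<leadsto> q \<or> q \<leadsto> p" "q \<leadsto> r \<or> r \<leadsto> q" "p \<leadsto> r \<or> r \<leadsto> p"
    "p \<leadsto> c \<or> c \<leadsto> p" "q \<leadsto> u \<or> u \<leadsto> q" "r \<leadsto> b \<or> b \<leadsto> r"
    using V semiconnex by auto
  \<comment> \<open>The first three instances force the cycle \<open>q \<leadsto> p\<close>,
    \<open>p \<leadsto> r\<close>, \<open>r \<leadsto> q\<close>. Then \<open>q \<leadsto> u\<close>
    fails for either direction between \<open>b\<close> and \<open>r\<close>, and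
    \<open>u \<leadsto> q\<close> forces \<open>b \<leadsto> r\<close> and
    \<open>c \<leadsto> p\<close>, completing a \<open>P7_minus\<close>.\<close>
  ultimately show False
    using triangle a p q r
      delta_free[of b c p u q] delta_free[of u b r c p] delta_free[of c u q b r]
      delta_free[of p u r b q] P7_minus_free[of u b r c q p, unfolded P7_minus_copy_def]
      delta_free[of p u c a q]
      delta_free[of q u b a r] P7_minus_free[of u a r q b p, unfolded P7_minus_copy_def]
    by satx
qed

text \<open>The mirror image: now each vertex \<open>v\<close> of the triangle has to make up for
  two out-neighbours of \<open>a\<close>, namely \<open>v\<close> itself and its predecessor. The
  vertices gained dominate \<open>a\<close>, and one of them dominates the successor of
  \<open>v\<close>.\<close>

lemma score_greater_of_tied_triangle:
  assumes triangle: "u \<leadsto> b" "b \<leadsto> c" "c \<leadsto> u"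
    and tied: "score u = score b" "score b = score c"
    and a: "a \<leadsto> u" "a \<leadsto> b" "a \<leadsto> c"
  shows "score u < score a"
proof (rule ccontr)
  assume "\<not> score u < score a"
  then have le: "score a \<le> score u" "score a \<le> score b" "score a \<le> score c"
    using tied by auto
  have ex: "\<exists>p. p \<leadsto> a \<and> v \<leadsto> p \<and> p \<leadsto> w"
    if vw: "a \<leadsto> v" "a \<leadsto> w" "a \<leadsto> x" "x \<leadsto> v" "w \<leadsto> x" "v \<leadsto> w" "score a \<le> score v" for v w x
  proof -
    have "v \<noteq> x" "\<not> v \<leadsto> x" using vw irrefl asym by blast+
    then obtain p p' where p: "v \<leadsto> p" "v \<leadsto> p'" "\<not> a \<leadsto> p" "\<not> a \<leadsto> p'" "p \<noteq> p'"
      using two_outneighbours[of a v v x] vw irrefl by blast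
    have "p \<leadsto> a" "p' \<leadsto> a"
      using p vw asym in_verts semiconnex[of a p] semiconnex[of a p'] by blast+
    moreover have "\<not> (w \<leadsto> p \<and> w \<leadsto> p')"
      using delta_free[of a v w p p'] p vw \<open>p \<leadsto> a\<close> \<open>p' \<leadsto> a\<close> irrefl by blast
    moreover have "p \<noteq> w" "p' \<noteq> w" using p vw asym by blast+
    ultimately show ?thesis
      using p vw in_verts semiconnex[of p w] semiconnex[of p' w] by blast
  qed
  obtain p where p: "p \<leadsto> a" "u \<leadsto> p" "p \<leadsto> b" using ex[of u b c] triangle a le by blast
  obtain q where q: "q \<leadsto> a" "b \<leadsto> q" "q \<leadsto> c" using ex[of b c u] triangle a le by blast
  obtain r where r: "r \<leadsto> a" "c \<leadsto> r" "r \<leadsto> u" using ex[of c u b] triangle a le by blast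
  have V: "{u, b, c, p, q, r} \<subseteq> V" using triangle p q r in_verts by auto
  have "p \<noteq> q" "q \<noteq> r" "p \<noteq> r" "p \<noteq> c" "q \<noteq> u" "r \<noteq> b"
    using p q r a asym by blast+
  moreover have "c \<noteq> a" "b \<noteq> a" "u \<noteq> p" "b \<noteq> q" "u \<noteq> a" "b \<noteq> p" "c \<noteq> q" "u \<noteq> r"
    using triangle a p q r irrefl asym by blast+
  moreover from calculation have "p \<leadsto> q \<or> q \<leadsto> p" "q \<leadsto> r \<or> r \<leadsto> q" "p \<leadsto> r \<or> r \<leadsto> p"
    "p \<leadsto> c \<or> c \<leadsto> p" "q \<leadsto> u \<or> u \<leadsto> q" "r \<leadsto> b \<or> b \<leadsto> r"
    using V semiconnex by auto
  \<comment> \<open>\<open>u \<leadsto> q\<close> fails for either direction between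
    \<open>p\<close> and \<open>c\<close>. So \<open>q \<leadsto> u\<close>, which forces
    \<open>r \<leadsto> b\<close> and \<open>p \<leadsto> c\<close>, then
    \<open>q \<leadsto> p\<close>, \<open>p \<leadsto> r\<close>, \<open>r \<leadsto> q\<close>,
    completing a \<open>P7_minus\<close> without \<open>a\<close>.\<close>
  ultimately show False
    using triangle a p q r
      delta_free[of u p q c a] delta_free[of c p r b a] delta_free[of c u p b q]
      P7_minus_free[of u q p a b c, unfolded P7_minus_copy_def]
      delta_free[of b q r u a]
      delta_free[of u b p c q] delta_free[of c u r b p] delta_free[of b c q u r]
      P7_minus_free[of p r b q c u, unfolded P7_minus_copy_def]
    by satx
qed

end

subsection \<open>Reversed paths\<close>

lemma vwalk_arcs_successor:
  "\<lbrakk>s \<in> set p; s \<noteq> last p\<rbrakk> \<Longrightarrow> \<exists>t. (s, t) \<in> set (vwalk_arcs p)"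
  by (induction p rule: vwalk_arcs.induct) auto

text \<open>Vertices are added in order of increasing \<open>f\<close>. The new vertex
  \<open>x\<close> has no out-arc, and the only possible arc into it comes from the end of an
  existing path, which it extends; otherwise \<open>x\<close> starts a path of its own.\<close>

lemma path_partition_exists:
  fixes f :: "'a \<Rightarrow> nat"
  assumes "finite V" "E \<subseteq> V \<times> V"
    and "\<And>u v. (u, v) \<in> E \<Longrightarrow> f u < f v"
    and "\<And>u v w. \<lbrakk>(u, v) \<in> E; (u, w) \<in> E\<rbrakk> \<Longrightarrow> v = w"
    and "\<And>u v w. \<lbrakk>(u, w) \<in> E; (v, w) \<in> E\<rbrakk> \<Longrightarrow> u = v"
  shows "\<exists>\<P>. (\<forall>p \<in> \<P>. p \<noteq> [] \<and> distinct p) \<and> pairwise (\<lambda>p q. set p \<inter> set q = {}) \<P> \<and>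
    (\<Union>p \<in> \<P>. set p) = V \<and> (\<Union>p \<in> \<P>. set (vwalk_arcs p)) = E"
  using assms
proof (induction V arbitrary: E rule: finite_ranking_induct[where f = f])
  case empty
  then show ?case by (intro exI[of _ "{}"]) auto
next
  case (insert x S)
  show ?case
  proof (cases "x \<in> S")
    case True
    then show ?thesis
      using insert.IH[of E] insert.prems by (simp add: insert_absorb)
  next
    case notin: False
    define E' where "E' = E \<inter> S \<times> S"
    have "\<exists>\<P>. (\<forall>p \<in> \<P>. p \<noteq> [] \<and> distinct p) \<and> pairwise (\<lambda>p q. set p \<inter> set q = {}) \<P> \<and>
      (\<Union>p \<in> \<P>. set p) = S \<and> (\<Union>p \<in> \<P>. set (vwalk_arcs p)) = E'"
      using insert.prems unfolding E'_def by (intro insert.IH) blast+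
    then obtain \<P> where paths: "\<forall>p \<in> \<P>. p \<noteq> [] \<and> distinct p"
      and disj: "pairwise (\<lambda>p q. set p \<inter> set q = {}) \<P>"
      and cover: "(\<Union>p \<in> \<P>. set p) = S"
      and arcs: "(\<Union>p \<in> \<P>. set (vwalk_arcs p)) = E'"
      by blast
    have from_x: "(x, v) \<notin> E" for v
      using insert.prems(1) insert.prems(2)[of x v] insert.hyps by fastforce
    show ?thesis
    proof (cases "\<exists>s. (s, x) \<in> E")
      case False
      then have "E = E'" using insert.prems(1) from_x unfolding E'_def by auto
      have "pairwise (\<lambda>p q. set p \<inter> set q = {}) (insert [x] \<P>)"
        using disj cover notin by (auto simp: pairwise_insert)
      then show ?thesis
        using paths cover arcs \<open>E = E'\<close> by (intro exI[of _ "insert [x] \<P>"]) simp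
    next
      case True
      then obtain s where s: "(s, x) \<in> E" by blast
      then have "s \<in> S" using insert.prems(1) from_x by blast
      then obtain p where p: "p \<in> \<P>" "s \<in> set p" using cover by blast
      have E: "E = insert (s, x) E'"
      proof (intro equalityI subsetI)
        fix e assume "e \<in> E"
        then obtain u v where e: "e = (u, v)" "(u, v) \<in> E" by (cases e) auto
        then have "u \<in> S" "v \<in> insert x S" using insert.prems(1) from_x by blast+
        then show "e \<in> insert (s, x) E'"
          using e s insert.prems(4)[of u x s] unfolding E'_def by auto
      next
        fix e assume "e \<in> insert (s, x) E'"
        then show "e \<in> E" using s unfolding E'_def by blast
      qed
      \<comment> \<open>If \<open>s\<close> were not the end of its path, it would have a second
        out-arc, besides the one to \<open>x\<close>.\<close>
      have "last p = s"
      proof (rule ccontr)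
        assume "last p \<noteq> s"
        then obtain t where "(s, t) \<in> E'" using vwalk_arcs_successor[of s p] p arcs by blast
        then show False using s insert.prems(3)[of s t x] notin unfolding E'_def by blast
      qed
      have split: "\<P> = insert p (\<P> - {p})" using p by blast
      have "x \<notin> set q" if "q \<in> \<P>" for q using that cover notin by blast
      then have "pairwise (\<lambda>p q. set p \<inter> set q = {}) (insert (p @ [x]) (\<P> - {p}))"
        using disj p by (auto simp: pairwise_def)
      moreover have "\<forall>q \<in> insert (p @ [x]) (\<P> - {p}). q \<noteq> [] \<and> distinct q"
        using paths p \<open>\<And>q. q \<in> \<P> \<Longrightarrow> x \<notin> set q\<close> by auto
      moreover have "(\<Union>q \<in> insert (p @ [x]) (\<P> - {p}). set q) = insert x S"
        unfolding cover[symmetric] by (subst (2) split) auto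
      moreover have "(\<Union>q \<in> insert (p @ [x]) (\<P> - {p}). set (vwalk_arcs q)) = E"
        unfolding E arcs[symmetric] using paths p \<open>last p = s\<close>
        by (subst (2) split) (auto simp: set_vwalk_arcs_snoc)
      ultimately show ?thesis by blast
    qed
  qed
qed

text \<open>\<open>R\<close> itself serves as the transitive tournament. The arcs to be reversed are
  those of \<open>R\<close> that \<open>T\<close> has backwards; they have in- and out-degree at
  most one, and the number of \<open>R\<close>-predecessors rises along them.\<close>

lemma path_reversal_of_transitiveI:
  assumes T: "tournament (with_proj T)"
    and R: "R \<subseteq> pverts T \<times> pverts T" "trans R" "irrefl R" "total_on (pverts T) R"
    and out_unique: "\<And>u v w. \<lbrakk>(u, v) \<in> parcs T \<inter> R\<inverse>; (u, w) \<in> parcs T \<inter> R\<inverse>\<rbrakk> \<Longrightarrow> v = w"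
    and in_unique: "\<And>u v w. \<lbrakk>(u, w) \<in> parcs T \<inter> R\<inverse>; (v, w) \<in> parcs T \<inter> R\<inverse>\<rbrakk> \<Longrightarrow> u = v"
  shows "path_reversal_of_transitive T"
proof -
  interpret T: tournament "with_proj T" by (rule T)
  define H where "H = \<lparr>pverts = pverts T, parcs = R\<rparr>"
  define E where "E = (parcs T)\<inverse> \<inter> R"
  define f where "f v = card {w. (w, v) \<in> R}" for v
  have fin: "finite (pverts T)" using T.finite_verts by simp
  have T_arcs: "(u, v) \<in> parcs T \<longleftrightarrow> (v, u) \<notin> parcs T"
    if "u \<in> pverts T" "v \<in> pverts T" "u \<noteq> v" for u v
    using T.tournament_arcs[of u v] that by simp
  have T_in: "u \<in> pverts T" "v \<in> pverts T" if "(u, v) \<in> parcs T" for u v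
    using T.tail_in_verts[of "(u, v)"] T.head_in_verts[of "(u, v)"] that by auto
  have T_irrefl: "u \<noteq> v" if "(u, v) \<in> parcs T" for u v
    using T.no_loops[of "(u, v)"] that by auto
  have R_asym: "(v, u) \<notin> R" if "(u, v) \<in> R" for u v
    using that R by (meson irrefl_def transD)
  have "f u < f v" if "(u, v) \<in> R" for u v
    unfolding f_def
  proof (rule psubset_card_mono)
    show "finite {w. (w, v) \<in> R}" by (rule finite_subset[OF _ fin]) (use R in auto)
    show "{w. (w, u) \<in> R} \<subset> {w. (w, v) \<in> R}"
      using that R by (auto simp: irrefl_def dest: transD)
  qed
  then have "\<exists>\<P>. (\<forall>p \<in> \<P>. p \<noteq> [] \<and> distinct p) \<and> pairwise (\<lambda>p q. set p \<inter> set q = {}) \<P> \<and>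
    (\<Union>p \<in> \<P>. set p) = pverts T \<and> (\<Union>p \<in> \<P>. set (vwalk_arcs p)) = E"
    using R(1) out_unique in_unique unfolding E_def
    by (intro path_partition_exists[where f = f] fin) blast+
  then obtain \<P> where \<P>: "\<forall>p \<in> \<P>. p \<noteq> [] \<and> distinct p"
    "pairwise (\<lambda>p q. set p \<inter> set q = {}) \<P>" "(\<Union>p \<in> \<P>. set p) = pverts T"
    "(\<Union>p \<in> \<P>. set (vwalk_arcs p)) = E"
    by blast
  have "tournament (with_proj H)"
  proof
    show "finite (arcs (with_proj H))"
      using R(1) fin finite_subset unfolding H_def by fastforce
  qed (use R fin R_asym in \<open>auto simp: H_def irrefl_def total_on_def arc_to_ends_def\<close>)
  moreover have "\<forall>p \<in> \<P>. vpath p (with_proj H)"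
    using \<P> unfolding vpath_def vwalk_def H_def E_def by auto
  moreover have "trans (parcs H)" using R(2) by (simp add: H_def)
  moreover have "T = reverse_arcs H (\<Union>p \<in> \<P>. set (vwalk_arcs p))"
  proof -
    have "(u, v) \<in> parcs T \<longleftrightarrow> (u, v) \<in> (R - E) \<union> E\<inverse>" for u v
    proof (cases "u \<in> pverts T \<and> v \<in> pverts T \<and> u \<noteq> v")
      case True
      then have "(u, v) \<in> R \<or> (v, u) \<in> R" using R(4) by (simp add: total_on_def)
      then show ?thesis using True T_arcs[of u v] R_asym[of u v] R_asym[of v u]
        by (auto simp: E_def)
    next
      case False
      then have "(u, v) \<notin> parcs T" "(u, v) \<notin> R" "(v, u) \<notin> parcs T" "(v, u) \<notin> R"
        using R(1,3) T_in[of u v] T_in[of v u] T_irrefl[of u v] T_irrefl[of v u]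
        unfolding irrefl_def by blast+
      then show ?thesis by (auto simp: E_def)
    qed
    then have "parcs T = (R - E) \<union> E\<inverse>" by auto
    then show ?thesis by (simp add: reverse_arcs_def H_def \<P>(4))
  qed
  ultimately show ?thesis
    unfolding path_reversal_of_transitive_def using \<P>(2) by blast
qed

subsection \<open>The order by score\<close>

context basic_free_tournament
begin

definition tied_triangle :: "'a \<Rightarrow> 'a \<Rightarrow> 'a \<Rightarrow> bool" where
  "tied_triangle u b c \<longleftrightarrow>
     u \<leadsto> b \<and> b \<leadsto> c \<and> c \<leadsto> u \<and> score u = score b \<and> score b = score c"

lemma tied_triangle_rotate: "tied_triangle u b c \<Longrightarrow> tied_triangle b c u"
  by (auto simp: tied_triangle_def)

lemma tied_triangle_arc_out:
  assumes "tied_triangle u b c" "u \<leadsto> a" "a \<noteq> b"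
  shows "score a < score u" "b \<leadsto> a" "c \<leadsto> a"
proof -
  have "a \<notin> {u, b, c}" "a \<in> V"
    using assms irrefl asym in_verts unfolding tied_triangle_def by blast+
  then show *: "b \<leadsto> a" "c \<leadsto> a"
    using tied_triangle_homogeneous[of u b c a] assms asym unfolding tied_triangle_def by blast+
  then show "score a < score u"
    using score_less_of_tied_triangle[of u b c a] assms unfolding tied_triangle_def by blast
qed

lemma tied_triangle_arc_in:
  assumes "tied_triangle u b c" "a \<leadsto> u" "a \<noteq> c"
  shows "score u < score a"
proof -
  have "a \<notin> {u, b, c}" "a \<in> V"
    using assms irrefl asym in_verts unfolding tied_triangle_def by blast+
  then have "a \<leadsto> b" "a \<leadsto> c"
    using tied_triangle_homogeneous[of u b c a] assms asym unfolding tied_triangle_def by blast+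
  then show ?thesis
    using score_greater_of_tied_triangle[of u b c a] assms unfolding tied_triangle_def by blast
qed

text \<open>Any other vertex is joined to \<open>u\<close> by an arc leaving or entering the
  triangle, along which the score strictly drops.\<close>

lemma tied_triangle_class:
  assumes "tied_triangle u b c" "a \<in> V" "score a = score u"
  shows "a \<in> {u, b, c}"
  using tied_triangle_arc_out[OF assms(1), of a] tied_triangle_arc_in[OF assms(1), of a]
    assms semiconnex[of a u] in_verts unfolding tied_triangle_def by fastforce

text \<open>The backward arcs either go up in score or are cut arcs. Two of the first kind with a
  common tail or head would form a transitive triple with rising score; a cut arc shares neither
  tail nor head with another backward arc, by the score drop at its triangle.\<close>

lemma exists_score_order:
  obtains R where "R \<subseteq> V \<times> V" "trans R" "irrefl R" "total_on V R"
    and "\<And>u v w. \<lbrakk>(u, v) \<in> A \<inter> R\<inverse>; (u, w) \<in> A \<inter> R\<inverse>\<rbrakk> \<Longrightarrow> v = w"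
    and "\<And>u v w. \<lbrakk>(u, w) \<in> A \<inter> R\<inverse>; (v, w) \<in> A \<inter> R\<inverse>\<rbrakk> \<Longrightarrow> u = v"
proof -
  obtain g :: "'a \<Rightarrow> nat" where g: "inj_on g V"
    using finite_imp_inj_to_nat_seg[OF finite_verts] by blast
  txt \<open>
    \<open>cut v w\<close> marks the arc of a tied triangle that becomes backward: the one entering the vertex
    that is least with respect to the auxiliary enumeration \<open>g\<close>.
  \<close>
  define cut where "cut v w \<longleftrightarrow> (\<exists>x. tied_triangle w x v \<and> g w < g x \<and> g w < g v)" for v w
  define tie where "tie v w \<longleftrightarrow> v \<leadsto> w \<and> \<not> cut v w \<or> cut w v" for v w
  define R where "R = {(v, w). v \<in> V \<and> w \<in> V \<and>
    (score w < score v \<or> score v = score w \<and> tie v w)}"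
  have cut_arc: "v \<leadsto> w" "score v = score w" if "cut v w" for v w
    using that unfolding cut_def tied_triangle_def by auto
  have tie_irrefl: "\<not> tie v v" for v
    using cut_arc irrefl unfolding tie_def by blast
  have tie_asym: "\<not> tie w v" if "tie v w" for v w
    using that cut_arc asym unfolding tie_def by blast
  \<comment> \<open>Opened at its least vertex \<open>m\<close>, the triangle is ordered
    \<open>m\<close>, \<open>x\<close>, \<open>v\<close>, and \<open>v \<leadsto> m\<close> is its
    only cut arc.\<close>
  have tie_triangle: "tie m x \<and> tie x v \<and> tie m v"
    if tri: "tied_triangle m x v" and min: "g m < g x" "g m < g v" for m x v
  proof -
    have arcs: "m \<leadsto> x" "x \<leadsto> v" "v \<leadsto> m" using tri unfolding tied_triangle_def by auto
    have "cut v m" using tri min unfolding cut_def by blast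
    moreover have "\<not> cut m x"
    proof
      assume "cut m x"
      then have "g x < g m" unfolding cut_def by blast
      then show False using min by simp
    qed
    moreover have "\<not> cut x v"
    proof
      assume "cut x v"
      then obtain y where y: "tied_triangle v y x" "g v < g y" unfolding cut_def by blast
      have "score m = score v" using tri unfolding tied_triangle_def by simp
      \<comment> \<open>\<open>m\<close> is an out-neighbour of \<open>v\<close> with equal score,
        hence the successor of \<open>v\<close> in every tied triangle.\<close>
      then have "y = m"
        using tied_triangle_arc_out(1)[OF y(1), of m] arcs by auto
      then show False using y min by simp
    qed
    ultimately show ?thesis using arcs unfolding tie_def by blast
  qed
  have tie_cyc: "\<exists>m x v. {p, q, r} = {m, x, v} \<and> tie m x \<and> tie x v \<and> tie m v"
    if tri: "tied_triangle p q r" for p q r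
  proof -
    have "p \<in> V" "q \<in> V" "r \<in> V" "p \<noteq> q" "q \<noteq> r" "p \<noteq> r"
      using tri in_verts irrefl asym unfolding tied_triangle_def by blast+
    then have "g p \<noteq> g q" "g q \<noteq> g r" "g p \<noteq> g r" using g by (auto simp: inj_on_def)
    then consider "g p < g q" "g p < g r" | "g q < g r" "g q < g p" | "g r < g p" "g r < g q"
      by linarith
    then show ?thesis
    proof cases
      case 1
      then show ?thesis using tie_triangle[OF tri] by blast
    next
      case 2
      then have "tie q r \<and> tie r p \<and> tie q p"
        by (intro tie_triangle tied_triangle_rotate[OF tri])
      then show ?thesis by (intro exI[of _ q] exI[of _ r] exI[of _ p]) auto
    next
      case 3
      then have "tie r p \<and> tie p q \<and> tie r q"
        by (intro tie_triangle tied_triangle_rotate[OF tied_triangle_rotate[OF tri]])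
      then show ?thesis by (intro exI[of _ r] exI[of _ p] exI[of _ q]) auto
    qed
  qed
  have tie_trans: "tie x z"
    if V: "x \<in> V" "y \<in> V" "z \<in> V" and score: "score x = score y" "score y = score z"
      and tie: "tie x y" "tie y z" for x y z
  proof -
    have ne: "x \<noteq> y" "y \<noteq> z" "x \<noteq> z" using tie tie_irrefl tie_asym by blast+
    show ?thesis
    \<comment> \<open>A score class with a tied triangle consists of that triangle alone, on which
      \<open>tie\<close> is linear. In any other class \<open>tie\<close> is the arc relation, which
      is transitive as it has no cyclic triangle there.\<close>
    proof (cases "\<exists>p q r. tied_triangle p q r \<and> score p = score x")
      case True
      then obtain p q r where pqr: "tied_triangle p q r" "score p = score x" by blast
      then have "{x, y, z} \<subseteq> {p, q, r}"
        using tied_triangle_class[OF pqr(1)] V score by auto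
      moreover obtain m a v where mav: "{p, q, r} = {m, a, v}" "tie m a" "tie a v" "tie m v"
        using tie_cyc[OF pqr(1)] by blast
      ultimately have "x \<in> {m, a, v}" "y \<in> {m, a, v}" "z \<in> {m, a, v}" by auto
      then show ?thesis
        using mav(2-4) ne tie tie_asym by blast
    next
      case False
      then have no_cut: "\<not> cut v w" if "score w = score x" for v w
        using that unfolding cut_def by auto
      then have "x \<leadsto> y" "y \<leadsto> z"
        using tie score unfolding tie_def by auto
      then have "\<not> z \<leadsto> x"
        using False score unfolding tied_triangle_def by auto
      then have "x \<leadsto> z" using V ne semiconnex by blast
      then show ?thesis using no_cut score unfolding tie_def by auto
    qed
  qed
  have backward: "u \<leadsto> v \<and> (score u < score v \<or> cut u v)" if "(u, v) \<in> A \<inter> R\<inverse>" for u v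
    using that asym unfolding R_def tie_def by auto
  show thesis
  proof
    show "R \<subseteq> V \<times> V" unfolding R_def by auto
    show "irrefl R" using tie_irrefl unfolding R_def irrefl_def by auto
    show "trans R"
    proof (rule transI)
      fix x y z assume "(x, y) \<in> R" "(y, z) \<in> R"
      then show "(x, z) \<in> R"
        using tie_trans[of x y z] unfolding R_def by auto
    qed
    show "total_on V R"
    proof (rule total_onI)
      fix x y assume "x \<in> V" "y \<in> V" "x \<noteq> y"
      then show "(x, y) \<in> R \<or> (y, x) \<in> R"
        using semiconnex[of x y] unfolding R_def tie_def
        by (cases "score x" "score y" rule: linorder_cases) auto
    qed
  next
    fix u v w assume "(u, v) \<in> A \<inter> R\<inverse>" "(u, w) \<in> A \<inter> R\<inverse>"
    then have uv: "u \<leadsto> v" "score u < score v \<or> cut u v"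
      and uw: "u \<leadsto> w" "score u < score w \<or> cut u w"
      using backward by blast+
    show "v = w"
    proof (rule ccontr)
      assume "v \<noteq> w"
      \<comment> \<open>All out-neighbours of \<open>u\<close> except its successor in the triangle
        have smaller score, so a cut arc leaves no room for a second backward arc.\<close>
      have no_cut: False if cut: "cut u a" "u \<leadsto> b" "a \<noteq> b" "score u \<le> score b" for a b
      proof -
        obtain x where "tied_triangle a x u" using cut(1) unfolding cut_def by blast
        then have "tied_triangle u a x" by (rule tied_triangle_rotate[OF tied_triangle_rotate])
        then show False using tied_triangle_arc_out(1)[of u a x b] cut by auto
      qed
      then have "score u < score v" "score u < score w"
        using uv uw \<open>v \<noteq> w\<close> cut_arc(2) by (metis less_imp_le order_refl)+
      moreover have "v \<leadsto> w \<or> w \<leadsto> v" using uv uw \<open>v \<noteq> w\<close> in_verts semiconnex by blast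
      ultimately show False
        using score_le_of_transitive_triple[of u v w] score_le_of_transitive_triple[of u w v] uv uw
        by auto
    qed
  next
    fix u v w assume "(u, w) \<in> A \<inter> R\<inverse>" "(v, w) \<in> A \<inter> R\<inverse>"
    then have uw: "u \<leadsto> w" "score u < score w \<or> cut u w"
      and vw: "v \<leadsto> w" "score v < score w \<or> cut v w"
      using backward by blast+
    show "u = v"
    proof (rule ccontr)
      assume "u \<noteq> v"
      have no_cut: False if cut: "cut a w" "b \<leadsto> w" "a \<noteq> b" "score b \<le> score w" for a b
      proof -
        obtain x where "tied_triangle w x a" using cut(1) unfolding cut_def by blast
        then show False using tied_triangle_arc_in[of w x a b] cut by auto
      qed
      then have "score u < score w" "score v < score w"
        using uw vw \<open>u \<noteq> v\<close> cut_arc(2) by (metis less_imp_le order_refl)+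
      moreover have "u \<leadsto> v \<or> v \<leadsto> u" using uw vw \<open>u \<noteq> v\<close> in_verts semiconnex by blast
      ultimately show False
        using score_le_of_transitive_triple[of u v w] score_le_of_transitive_triple[of v u w] uw vw
        by auto
    qed
  qed
qed

end

subsection \<open>Copies of the basic tournaments\<close>

lemma arcs_ends_induce_with_proj [simp]:
  "arcs_ends (with_proj T \<restriction> X) = parcs T \<inter> X \<times> X"
  by (auto simp: arcs_ends_conv image_iff)

text \<open>Between distinct vertices of \<open>S\<close> some arc exists, and \<open>T\<close> has
  no loops or opposite arcs. A map that preserves arcs is therefore injective and reflects arcs as
  well.\<close>

lemma digraph_iso_induce_image:
  assumes S: "parcs S \<subseteq> pverts S \<times> pverts S"
    "\<forall>i \<in> pverts S. \<forall>j \<in> pverts S. i \<noteq> j \<longrightarrow> (i, j) \<in> parcs S \<or> (j, i) \<in> parcs S"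
    and T: "\<And>u v. (u, v) \<in> parcs T \<Longrightarrow> (v, u) \<notin> parcs T"
    and k: "\<forall>(i, j) \<in> parcs S. (k i, k j) \<in> parcs T"
  shows "digraph_iso (with_proj T \<restriction> (k ` pverts S)) (with_proj S)"
proof -
  let ?G = "with_proj T \<restriction> (k ` pverts S)"
  define h where "h = the_inv_into (pverts S) k"
  have k: "(k i, k j) \<in> parcs T" if "(i, j) \<in> parcs S" for i j
    using that k by blast
  have S2: "(i, j) \<in> parcs S \<or> (j, i) \<in> parcs S" if "i \<in> pverts S" "j \<in> pverts S" "i \<noteq> j" for i j
    using that S(2) by blast
  have "inj_on k (pverts S)"
  proof (rule inj_onI)
    fix i j assume "i \<in> pverts S" "j \<in> pverts S" "k i = k j"
    then show "i = j" using S2[of i j] k[of i j] k[of j i] T[of "k i" "k i"] by auto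
  qed
  then have h: "h (k i) = i" if "i \<in> pverts S" for i
    using that by (simp add: h_def the_inv_into_f_f)
  have arcs: "(i, j) \<in> parcs S" if "i \<in> pverts S" "j \<in> pverts S" "(k i, k j) \<in> parcs T" for i j
    using that S2[of i j] k[of j i] T[of "k i" "k j"] T[of "k i" "k i"] by (cases "i = j") auto
  \<comment> \<open>The isomorphism starts at the induced subdigraph, so it is built from the
    inverse \<open>h\<close> of \<open>k\<close>.\<close>
  define iso where "iso = \<lparr>iso_verts = h, iso_arcs = map_prod h h, iso_head = snd, iso_tail = fst\<rparr>"
  have "wf_digraph ?G" by unfold_locales auto
  moreover have "inj_on h (k ` pverts S)" by (rule inj_onI) (auto simp: h)
  moreover have "inj_on (map_prod h h) (arcs ?G)" by (rule inj_onI) (auto simp: h)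
  ultimately have "pre_digraph.digraph_isomorphism ?G iso"
    by (simp add: pre_digraph.digraph_isomorphism_def iso_def)
  moreover have "h ` k ` pverts S = pverts S" using h by force
  moreover have "map_prod h h ` arcs ?G = parcs S"
  proof (intro equalityI subsetI)
    fix e assume "e \<in> map_prod h h ` arcs ?G"
    then show "e \<in> parcs S" using h arcs by auto
  next
    fix e assume e: "e \<in> parcs S"
    then obtain i j where "e = (i, j)" "i \<in> pverts S" "j \<in> pverts S" using S(1) by auto
    then show "e \<in> map_prod h h ` arcs ?G"
      using e k[of i j] h by (intro image_eqI[of _ _ "(k i, k j)"]) auto
  qed
  ultimately show ?thesis
    unfolding digraph_iso_def app_iso_def with_proj_def[of S]
    by (intro exI[of _ iso]) (simp add: iso_def)
qed

lemma pverts_T5: "pverts T5 = {1, 2, 3, 4, 5}"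
  by (simp add: T5_def simp_from_to)

lemma parcs_T5:
  "parcs T5 = {(1, 2), (1, 3), (2, 3), (2, 4), (3, 4), (3, 5), (4, 5), (4, 1), (5, 1), (5, 2)}"
  (is "_ = ?R")
proof
  \<comment> \<open>The bounded quantifiers unfold into 25 pairs of numerals, for which the residue
    is computed.\<close>
  have table: "\<forall>i \<in> {1, 2, 3, 4, 5 :: int}. \<forall>j \<in> {1, 2, 3, 4, 5}.
    (j - i) mod 5 \<in> {1, 2} \<longrightarrow> (i, j) \<in> ?R"
    by (simp only: ball_simps simp_thms, intro conjI, simp_all only: mem_simps) simp_all
  show "parcs T5 \<subseteq> ?R"
  proof (rule subrelI)
    fix i j assume "(i, j) \<in> parcs T5"
    then have "i \<in> {1, 2, 3, 4, 5}" "j \<in> {1, 2, 3, 4, 5}" "(j - i) mod 5 \<in> {1, 2}"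
      unfolding pverts_T5[symmetric]
      by (simp_all only: T5_def pair_pre_digraph.simps mem_Collect_eq prod.case)
    then show "(i, j) \<in> ?R" by (rule table[THEN bspec, THEN bspec, THEN mp])
  qed
qed (simp add: T5_def)

text \<open>A presentation of \<open>P7_minus\<close> as a pair digraph, the form that
  \<open>digraph_iso_induce_image\<close> takes, with the arcs in the order of
  \<open>P7_minus_copy\<close>.\<close>

definition P7_minus_pair :: "int pair_pre_digraph" where
  "P7_minus_pair = \<lparr>pverts = {1, 2, 3, 4, 5, 6},
     parcs = {(1, 2), (1, 3), (1, 5), (2, 3), (2, 4), (2, 6), (3, 4), (3, 5), (4, 5), (4, 6), (4, 1),
       (5, 6), (5, 2), (6, 1), (6, 3)}\<rparr>"

lemma P7_minus_eq: "P7_minus = with_proj P7_minus_pair"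
proof -
  have pverts: "pverts P7 - {7} = {1, 2, 3, 4, 5, 6}"
    by (auto simp: P7_def)
  have "{e \<in> parcs P7. fst e \<noteq> 7 \<and> snd e \<noteq> 7} \<subseteq> parcs P7_minus_pair" (is "?L \<subseteq> _")
  proof -
    have table: "\<forall>i \<in> {1, 2, 3, 4, 5, 6 :: int}. \<forall>j \<in> {1, 2, 3, 4, 5, 6}.
      (j - i) mod 7 \<in> {1, 2, 4} \<longrightarrow> (i, j) \<in> parcs P7_minus_pair"
      unfolding P7_minus_pair_def pair_pre_digraph.simps
      by (simp only: ball_simps simp_thms, intro conjI, simp_all only: mem_simps) simp_all
    show ?thesis
    proof (rule subrelI)
      fix i j assume "(i, j) \<in> ?L"
      then have "i \<in> {1, 2, 3, 4, 5, 6}" "j \<in> {1, 2, 3, 4, 5, 6}" "(j - i) mod 7 \<in> {1, 2, 4}"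
        unfolding pverts[symmetric]
        by (simp_all only: P7_def pair_pre_digraph.simps mem_Collect_eq prod.case fst_conv snd_conv
          Diff_iff singleton_iff) blast+
      then show "(i, j) \<in> parcs P7_minus_pair" by (rule table[THEN bspec, THEN bspec, THEN mp])
    qed
  qed
  moreover have "parcs P7_minus_pair \<subseteq> ?L"
    by (simp add: P7_def P7_minus_pair_def)
  ultimately show ?thesis
    using pverts
    by (simp add: P7_minus_def pre_digraph.del_vert_def with_proj_def P7_minus_pair_def
      set_eq_subset)
qed

lemma T5_semiconnex:
  "\<forall>i \<in> pverts T5. \<forall>j \<in> pverts T5. i \<noteq> j \<longrightarrow> (i, j) \<in> parcs T5 \<or> (j, i) \<in> parcs T5"
  unfolding pverts_T5 parcs_T5
  by (simp only: ball_simps simp_thms, intro conjI, simp_all only: mem_simps) simp_all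

lemma P7_minus_pair_semiconnex:
  "\<forall>i \<in> pverts P7_minus_pair. \<forall>j \<in> pverts P7_minus_pair. i \<noteq> j \<longrightarrow>
    (i, j) \<in> parcs P7_minus_pair \<or> (j, i) \<in> parcs P7_minus_pair"
  unfolding P7_minus_pair_def pair_pre_digraph.simps
  by (simp only: ball_simps simp_thms, intro conjI, simp_all only: mem_simps) simp_all

lemma delta_free_tournamentI:
  assumes T: "tournament (with_proj T)" and free: "free_of (with_proj T) (with_proj Delta_1_2_2)"
  shows "delta_free_tournament (pverts T) (parcs T)"
proof
  interpret T: tournament "with_proj T" by (rule T)
  show "finite (pverts T)" using T.finite_verts by simp
  show subset: "parcs T \<subseteq> pverts T \<times> pverts T"
    using T.tail_in_verts T.head_in_verts by auto
  show irrefl: "(u, u) \<notin> parcs T" for u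
    using T.no_loops[of "(u, u)"] by auto
  show semiconnex: "(u, v) \<in> parcs T \<or> (v, u) \<in> parcs T"
    if "u \<in> pverts T" "v \<in> pverts T" "u \<noteq> v" for u v
    using T.tournament_arcs[of u v] that by auto
  show asym: "(v, u) \<notin> parcs T" if "(u, v) \<in> parcs T" for u v
  proof -
    have "u \<in> pverts T" "v \<in> pverts T" "u \<noteq> v" using that subset irrefl by blast+
    then show ?thesis using T.tournament_arcs[of u v] that by simp
  qed
  show "y = y' \<or> z = z'"
    if arcs: "(x, y) \<in> parcs T" "(x, y') \<in> parcs T" "(y, z) \<in> parcs T" "(y, z') \<in> parcs T"
      "(y', z) \<in> parcs T" "(y', z') \<in> parcs T" "(z, x) \<in> parcs T" "(z', x) \<in> parcs T"
    for x y y' z z'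
  proof (rule ccontr)
    assume "\<not> (y = y' \<or> z = z')"
    then have "y \<noteq> y'" "z \<noteq> z'" by auto
    moreover have "y \<in> pverts T" "y' \<in> pverts T" "z \<in> pverts T" "z' \<in> pverts T"
      using arcs subset by blast+
    ultimately have "(y, y') \<in> parcs T \<or> (y', y) \<in> parcs T" "(z, z') \<in> parcs T \<or> (z', z) \<in> parcs T"
      using semiconnex by blast+
    \<comment> \<open>Each pair is renamed along its arc, so that \<open>Delta_y1\<close> goes to
      the tail \<open>a\<close> and \<open>Delta_z1\<close> to the tail \<open>c\<close>.\<close>
    then obtain a b c d where ab: "(a, b) \<in> parcs T" "a = y \<and> b = y' \<or> a = y' \<and> b = y"
      and cd: "(c, d) \<in> parcs T" "c = z \<and> d = z' \<or> c = z' \<and> d = z"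
      by metis
    define k where "k i = (case i of Delta_x \<Rightarrow> x | Delta_y1 \<Rightarrow> a | Delta_y2 \<Rightarrow> b |
      Delta_z1 \<Rightarrow> c | Delta_z2 \<Rightarrow> d)" for i
    have "(x, a) \<in> parcs T" "(x, b) \<in> parcs T" "(c, x) \<in> parcs T" "(d, x) \<in> parcs T"
      "(a, c) \<in> parcs T" "(a, d) \<in> parcs T" "(b, c) \<in> parcs T" "(b, d) \<in> parcs T"
      using arcs ab(2) cd(2) by blast+
    then have "\<forall>(i, j) \<in> parcs Delta_1_2_2. (k i, k j) \<in> parcs T"
      using ab(1) cd(1) by (simp add: Delta_1_2_2_def k_def)
    moreover have "parcs Delta_1_2_2 \<subseteq> pverts Delta_1_2_2 \<times> pverts Delta_1_2_2"
      by (simp add: Delta_1_2_2_def)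
    moreover have "\<forall>i \<in> pverts Delta_1_2_2. \<forall>j \<in> pverts Delta_1_2_2. i \<noteq> j \<longrightarrow>
      (i, j) \<in> parcs Delta_1_2_2 \<or> (j, i) \<in> parcs Delta_1_2_2"
      by (simp add: Delta_1_2_2_def)
    ultimately have "digraph_iso (with_proj T \<restriction> (k ` pverts Delta_1_2_2)) (with_proj Delta_1_2_2)"
      by (intro digraph_iso_induce_image asym)
    moreover have "k ` pverts Delta_1_2_2 \<subseteq> pverts T"
      using arcs ab cd subset by (auto simp: Delta_1_2_2_def k_def)
    ultimately show False using free unfolding free_of_def by auto
  qed
qed

section \<open>Homogeneous sets and pairs formed by copies\<close>

locale delta_free_pair_digraph = delta_free_tournament "pverts T" "parcs T"
  for T :: "'a pair_pre_digraph"
begin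

notation arc (infix "\<leadsto>" 50)

lemma complete_to_singleton_left:
  assumes "X \<noteq> {}" "X \<subseteq> S" "v \<in> S" "\<And>x. x \<in> X \<Longrightarrow> v \<leadsto> x"
  shows "complete_to (with_proj T \<restriction> S) {v} X"
  using assms irrefl unfolding complete_to_def by auto

lemma complete_to_singleton_right:
  assumes "X \<noteq> {}" "X \<subseteq> S" "v \<in> S" "\<And>x. x \<in> X \<Longrightarrow> x \<leadsto> v"
  shows "complete_to (with_proj T \<restriction> S) X {v}"
  using assms irrefl unfolding complete_to_def by auto

text \<open>Only arcs from \<open>v\<close> into \<open>X\<close> need checking: if there are none,
  all of \<open>X\<close> dominates \<open>v\<close>. For a homogeneous pair, \<open>S\<close>
  leaves out the other class.\<close>

lemma homogeneous_set_induceI: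
  assumes "X \<noteq> {}" "X \<subseteq> S" "S \<subseteq> pverts T"
    and uniform: "\<And>v x y. \<lbrakk>v \<in> S - X; x \<in> X; y \<in> X; v \<leadsto> x\<rbrakk> \<Longrightarrow> v \<leadsto> y"
  shows "homogeneous_set (with_proj T \<restriction> S) X"
  unfolding homogeneous_set_def
proof (intro conjI ballI)
  fix v assume "v \<in> verts (with_proj T \<restriction> S) - X"
  then have v: "v \<in> S" "v \<notin> X" by auto
  show "complete_to (with_proj T \<restriction> S) {v} X \<or> complete_to (with_proj T \<restriction> S) X {v}"
  proof (cases "\<exists>x \<in> X. v \<leadsto> x")
    case True
    then have "v \<leadsto> y" if "y \<in> X" for y using uniform v that by blast
    then show ?thesis using complete_to_singleton_left[of X S v] assms(1,2) v(1) by blast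
  next
    case False
    then have "y \<leadsto> v" if "y \<in> X" for y using semiconnex[of v y] assms(2,3) v that by blast
    then show ?thesis using complete_to_singleton_right[of X S v] assms(1,2) v(1) by blast
  qed
qed (use assms in auto)

lemma T5_copy_homogeneous:
  assumes copy: "T5_copy v1 v2 v3 v4 v5"
  shows "\<exists>X. homogeneous_set (with_proj T) X \<and> digraph_iso (with_proj T \<restriction> X) (with_proj T5)"
proof -
  define X where "X = {v1, v2, v3, v4, v5}"
  have X: "X \<subseteq> pverts T" using copy in_verts unfolding T5_copy_def X_def by blast
  have uniform: "v \<leadsto> y" if "v \<in> pverts T - X" "x \<in> X" "y \<in> X" "v \<leadsto> x" for v x y
  proof -
    note copy2 = T5_copy_rotate[OF copy]
    note copy3 = T5_copy_rotate[OF copy2]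
    note copy4 = T5_copy_rotate[OF copy3]
    note copy5 = T5_copy_rotate[OF copy4]
    have v: "v \<in> pverts T" "v \<notin> {v1, v2, v3, v4, v5}" "v \<notin> {v2, v3, v4, v5, v1}"
      "v \<notin> {v3, v4, v5, v1, v2}" "v \<notin> {v4, v5, v1, v2, v3}" "v \<notin> {v5, v1, v2, v3, v4}"
      using that(1) unfolding X_def by blast+
    have "v \<leadsto> v2 \<longleftrightarrow> v \<leadsto> v1" "v \<leadsto> v3 \<longleftrightarrow> v \<leadsto> v1" "v \<leadsto> v4 \<longleftrightarrow> v \<leadsto> v1"
      "v \<leadsto> v5 \<longleftrightarrow> v \<leadsto> v1"
      using T5_uniform_step[OF copy v(1,2)] T5_uniform_step[OF copy2 v(1,3)]
        T5_uniform_step[OF copy3 v(1,4)] T5_uniform_step[OF copy4 v(1,5)]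
        T5_uniform_step[OF copy5 v(1,6)]
      by satx+
    then show ?thesis using that unfolding X_def by auto
  qed
  have "homogeneous_set (with_proj T \<restriction> pverts T) X"
    by (rule homogeneous_set_induceI[OF _ X subset_refl uniform]) (simp add: X_def)
  moreover have "with_proj T \<restriction> pverts T = with_proj T"
  proof -
    have "{e \<in> parcs T. fst e \<in> pverts T \<and> snd e \<in> pverts T} = parcs T"
      using arcs_subset by (simp add: set_eq_iff subset_iff mem_Times_iff) blast
    then show ?thesis by (simp add: induce_subgraph_def with_proj_def)
  qed
  moreover define k where "k i = (if i = 1 then v1 else if i = 2 then v2 else if i = 3 then v3
    else if i = 4 then v4 else v5)" for i :: int
  have "\<forall>(i, j) \<in> parcs T5. (k i, k j) \<in> parcs T"
    using copy unfolding parcs_T5 T5_copy_def by (simp only: ball_simps prod.case) (simp add: k_def)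
  then have "digraph_iso (with_proj T \<restriction> (k ` pverts T5)) (with_proj T5)"
    by (intro digraph_iso_induce_image asym T5_semiconnex) (simp_all add: pverts_T5 parcs_T5)
  moreover have "k ` pverts T5 = X" by (simp add: k_def X_def pverts_T5 insert_commute)
  ultimately show ?thesis by auto
qed

lemma out_degree_induce:
  assumes "v \<in> X"
  shows "out_degree (with_proj T \<restriction> X) v = card {w \<in> X. v \<leadsto> w}"
proof -
  have "out_arcs (with_proj T \<restriction> X) v = Pair v ` {w \<in> X. v \<leadsto> w}"
    using assms by (auto simp: out_arcs_def)
  then show ?thesis by (simp add: out_degree_def card_image inj_on_def)
qed

lemma P7_minus_copy_homogeneous:
  assumes copy: "P7_minus_copy v1 v2 v3 v4 v5 v6"
  shows "\<exists>D\<^sub>1 D\<^sub>2. homogeneous_pair (with_proj T) D\<^sub>1 D\<^sub>2 \<and>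
    digraph_iso (with_proj T \<restriction> (D\<^sub>1 \<union> D\<^sub>2)) P7_minus \<and>
    (D\<^sub>1, D\<^sub>2) = degree_partition (with_proj T \<restriction> (D\<^sub>1 \<union> D\<^sub>2))"
proof -
  \<comment> \<open>The deleted vertex 7 of \<open>P7\<close> dominates 1, 2, 4 and is dominated by
    3, 5, 6. Its deletion therefore lowers the out-degree of the latter three from 3 to 2.\<close>
  define D1 where "D1 = {v1, v2, v4}"
  define D2 where "D2 = {v3, v5, v6}"
  define X where "X = {v1, v2, v3, v4, v5, v6}"
  have union: "D1 \<union> D2 = X" by (auto simp: D1_def D2_def X_def)
  note arcs = copy[unfolded P7_minus_copy_def]
  have ne: "distinct [v1, v2, v3, v4, v5, v6]"
    using arcs irrefl by auto
  have X: "X \<subseteq> pverts T" using arcs in_verts unfolding X_def by blast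
  have disj: "D1 \<inter> D2 = {}" using ne by (auto simp: D1_def D2_def)
  have nonempty: "D1 \<noteq> {}" "D2 \<noteq> {}" by (simp_all add: D1_def D2_def)
  note copy2 = P7_minus_copy_rotate[OF copy]
  note copy3 = P7_minus_copy_rotate[OF copy2]
  have uniform: "v \<leadsto> v2 \<longleftrightarrow> v \<leadsto> v1" "v \<leadsto> v4 \<longleftrightarrow> v \<leadsto> v1" "v \<leadsto> v5 \<longleftrightarrow> v \<leadsto> v3" "v \<leadsto> v6 \<longleftrightarrow> v \<leadsto> v3"
    if "v \<in> pverts T - (D1 \<union> D2)" for v
  proof -
    have v: "v \<in> pverts T" "v \<notin> {v1, v2, v3, v4, v5, v6}" "v \<notin> {v2, v4, v6, v1, v3, v5}"
      "v \<notin> {v4, v1, v5, v2, v6, v3}"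
      using that unfolding union X_def by blast+
    show "v \<leadsto> v2 \<longleftrightarrow> v \<leadsto> v1" "v \<leadsto> v4 \<longleftrightarrow> v \<leadsto> v1" "v \<leadsto> v5 \<longleftrightarrow> v \<leadsto> v3" "v \<leadsto> v6 \<longleftrightarrow> v \<leadsto> v3"
      using P7_minus_uniform_step[OF copy v(1,2)] P7_minus_uniform_step[OF copy2 v(1,3)]
        P7_minus_uniform_step[OF copy3 v(1,4)]
      by satx+
  qed
  have "homogeneous_set (with_proj T \<restriction> (pverts T - D2)) D1"
  proof (rule homogeneous_set_induceI)
    fix v x y assume "v \<in> pverts T - D2 - D1" "x \<in> D1" "y \<in> D1" "v \<leadsto> x"
    then show "v \<leadsto> y" using uniform(1,2)[of v] unfolding D1_def by blast
  qed (use X union disj nonempty in blast)+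
  moreover have "homogeneous_set (with_proj T \<restriction> (pverts T - D1)) D2"
  proof (rule homogeneous_set_induceI)
    fix v x y assume "v \<in> pverts T - D1 - D2" "x \<in> D2" "y \<in> D2" "v \<leadsto> x"
    then show "v \<leadsto> y" using uniform(3,4)[of v] unfolding D2_def by blast
  qed (use X union disj nonempty in blast)+
  ultimately have "homogeneous_pair (with_proj T) D1 D2"
    using disj nonempty unfolding homogeneous_pair_def by simp
  moreover define k where "k i = (if i = 1 then v1 else if i = 2 then v2 else if i = 3 then v3
    else if i = 4 then v4 else if i = 5 then v5 else v6)" for i :: int
  have "\<forall>(i, j) \<in> parcs P7_minus_pair. (k i, k j) \<in> parcs T"
    using arcs unfolding P7_minus_pair_def pair_pre_digraph.simps
    by (simp only: ball_simps prod.case) (simp add: k_def)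
  then have "digraph_iso (with_proj T \<restriction> (k ` pverts P7_minus_pair)) (with_proj P7_minus_pair)"
    by (intro digraph_iso_induce_image asym P7_minus_pair_semiconnex)
      (simp_all add: P7_minus_pair_def)
  then have "digraph_iso (with_proj T \<restriction> (D1 \<union> D2)) P7_minus"
    by (simp add: union P7_minus_eq k_def X_def P7_minus_pair_def insert_commute)
  moreover have "(D1, D2) = degree_partition (with_proj T \<restriction> (D1 \<union> D2))"
  proof -
    have no_back: "\<not> v2 \<leadsto> v1" "\<not> v3 \<leadsto> v1" "\<not> v5 \<leadsto> v1" "\<not> v3 \<leadsto> v2" "\<not> v4 \<leadsto> v2"
      "\<not> v6 \<leadsto> v2" "\<not> v4 \<leadsto> v3" "\<not> v5 \<leadsto> v3" "\<not> v5 \<leadsto> v4" "\<not> v6 \<leadsto> v4" "\<not> v1 \<leadsto> v4"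
      "\<not> v6 \<leadsto> v5" "\<not> v2 \<leadsto> v5" "\<not> v1 \<leadsto> v6" "\<not> v3 \<leadsto> v6"
      using arcs asym by blast+
    have outs: "{w \<in> X. v1 \<leadsto> w} = {v2, v3, v5}" "{w \<in> X. v2 \<leadsto> w} = {v3, v4, v6}"
      "{w \<in> X. v3 \<leadsto> w} = {v4, v5}" "{w \<in> X. v4 \<leadsto> w} = {v5, v6, v1}"
      "{w \<in> X. v5 \<leadsto> w} = {v6, v2}" "{w \<in> X. v6 \<leadsto> w} = {v1, v3}"
      using no_back unfolding X_def by (auto simp: arcs irrefl)
    have deg: "out_degree (with_proj T \<restriction> X) v = (if v \<in> D1 then 3 else 2)" if "v \<in> X" for v
    proof -
      have "v = v1 \<or> v = v2 \<or> v = v3 \<or> v = v4 \<or> v = v5 \<or> v = v6"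
        using that by (simp add: X_def)
      then show ?thesis
        unfolding out_degree_induce[OF that] using ne by (elim disjE) (auto simp: outs D1_def)
    qed
    then show ?thesis
      using disj unfolding degree_partition_def union[symmetric] by auto
  qed
  ultimately show ?thesis by blast
qed

end

theorem theorem1p2:
  fixes T :: "'a pair_pre_digraph"
  assumes "tournament (with_proj T)"
    and "free_of (with_proj T) (with_proj Delta_1_2_2)"
  shows
    "(digraph_iso (with_proj T) (with_proj T5) \<or>
      digraph_iso (with_proj T) P7_minus \<or>
      digraph_iso (with_proj T) (with_proj P7))
   \<or> path_reversal_of_transitive T
   \<or> (\<exists>X. homogeneous_set (with_proj T) X \<and>
        (digraph_iso (with_proj T \<restriction> X) (with_proj T5) \<or>
         digraph_iso (with_proj T \<restriction> X) (with_proj P7)))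
   \<or> (\<exists>D\<^sub>1 D\<^sub>2. homogeneous_pair (with_proj T) D\<^sub>1 D\<^sub>2 \<and>
        digraph_iso (with_proj T \<restriction> (D\<^sub>1 \<union> D\<^sub>2)) P7_minus \<and>
        (D\<^sub>1, D\<^sub>2) = degree_partition (with_proj T \<restriction> (D\<^sub>1 \<union> D\<^sub>2)))"
proof -
  interpret delta_free_pair_digraph T
    unfolding delta_free_pair_digraph_def by (rule delta_free_tournamentI) (fact assms)+
  consider v1 v2 v3 v4 v5 where "T5_copy v1 v2 v3 v4 v5"
    | v1 v2 v3 v4 v5 v6 where "P7_minus_copy v1 v2 v3 v4 v5 v6"
    | "\<And>v1 v2 v3 v4 v5. \<not> T5_copy v1 v2 v3 v4 v5"
      "\<And>v1 v2 v3 v4 v5 v6. \<not> P7_minus_copy v1 v2 v3 v4 v5 v6"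
    by blast
  then show ?thesis
  proof cases
    case 1
    then show ?thesis using T5_copy_homogeneous by blast
  next
    case 2
    then show ?thesis using P7_minus_copy_homogeneous by blast
  next
    case 3
    then interpret basic_free_tournament "pverts T" "parcs T"
      by unfold_locales
    obtain R where "R \<subseteq> pverts T \<times> pverts T" "trans R" "irrefl R" "total_on (pverts T) R"
      "\<And>u v w. \<lbrakk>(u, v) \<in> parcs T \<inter> R\<inverse>; (u, w) \<in> parcs T \<inter> R\<inverse>\<rbrakk> \<Longrightarrow> v = w"
      "\<And>u v w. \<lbrakk>(u, w) \<in> parcs T \<inter> R\<inverse>; (v, w) \<in> parcs T \<inter> R\<inverse>\<rbrakk> \<Longrightarrow> u = v"
      by (rule exists_score_order) blast
    then have "path_reversal_of_transitive T"
      by (intro path_reversal_of_transitiveI[OF assms(1)])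
    then show ?thesis by blast
  qed
qed

end
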